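(* Let $n\ge 2$ and let $S\subseteq\mathbb{Z}_n$ with $0\notin S$. Then the mixed circulant graph $\mathrm{Circ}(\mathbb{Z}_n,S)$ is Eisenstein integral if and only if $\mathrm{Circ}(\mathbb{Z}_n,S)$ is HS-integral.
   Context: The mixed circulant graph $\mathrm{Circ}(\mathbb{Z}_n,S)$ has vertex set $\mathbb{Z}_n$ and directed edge set $\{(a,b): b-a\in S\}$. Its $(0,1)$-adjacency matrix is $\mathcal{A}=(a_{uv})$ with $a_{uv}=1$ if $(u,v)$ is an edge and $0$ otherwise. Its Hermitian-adjacency matrix of the second kind is $\mathcal{H}=(h_{uv})$ with $h_{uv}=1$ if both $(u,v)$ and $(v,u)$ are edges, $h_{uv}=\frac{1+i\sqrt3}{2}$ if only $(u,v)$ is an edge, $h_{uv}=\frac{1-i\sqrt3}{2}$ if only $(v,u)$ is an edge, and $h_{uv}=0$ otherwise. The graph is HS-integral if all eigenvalues of $\mathcal{H}$ are integers. It is Eisenstein integral if all eigenvalues of $\mathcal{A}$ are Eisenstein integers, i.e. of the form $a+b\omega_3$ with $a,b\in\mathbb{Z}$ and $\omega_3=\frac{-1+i\sqrt3}{2}$. *)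

theory Defs
  imports "Jordan_Normal_Form.Char_Poly" Complex_Main
begin

text \<open>A mixed graph on the vertex set \<open>{0..<n}\<close> is given by its set \<open>E\<close> of directed edges; an
  undirected edge is a pair of opposite directed edges.
  The ring \<open>\<int>\<close> modulo \<open>n\<close> is represented by the residues \<open>0, \<dots>, n - 1\<close>: as integers for the
  connection set \<open>S\<close>, and as natural numbers for the vertices, which are also the matrix indices.\<close>

definition Circ :: "nat \<Rightarrow> int set \<Rightarrow> (nat \<times> nat) set" where
  "Circ n S = {(a, b). a < n \<and> b < n \<and> (int b - int a) mod int n \<in> S}"

definition adj_mat :: "nat \<Rightarrow> (nat \<times> nat) set \<Rightarrow> complex mat" where
  "adj_mat n E = mat n n (\<lambda>(u, v). if (u, v) \<in> E then 1 else 0)"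

definition herm_adj_mat2 :: "nat \<Rightarrow> (nat \<times> nat) set \<Rightarrow> complex mat" where
  "herm_adj_mat2 n E = mat n n (\<lambda>(u, v).
     if (u, v) \<in> E \<and> (v, u) \<in> E then 1
     else if (u, v) \<in> E then (1 + \<i> * complex_of_real (sqrt 3)) / 2
     else if (v, u) \<in> E then (1 - \<i> * complex_of_real (sqrt 3)) / 2
     else 0)"

definition omega3 :: complex where
  "omega3 = (- 1 + \<i> * complex_of_real (sqrt 3)) / 2"

definition eisenstein_integers :: "complex set" where
  "eisenstein_integers = {of_int a + of_int b * omega3 | a b :: int. True}"

definition HS_integral :: "nat \<Rightarrow> (nat \<times> nat) set \<Rightarrow> bool" where
  "HS_integral n E \<longleftrightarrow> (\<forall>x. eigenvalue (herm_adj_mat2 n E) x \<longrightarrow> x \<in> \<int>)"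

definition eisenstein_integral :: "nat \<Rightarrow> (nat \<times> nat) set \<Rightarrow> bool" where
  "eisenstein_integral n E \<longleftrightarrow> (\<forall>x. eigenvalue (adj_mat n E) x \<longrightarrow> x \<in> eisenstein_integers)"

end

theory Submission
  imports Defs "HOL-Library.Indicator_Function"
begin

text \<open>
  Both matrices are circulant: their entry at \<open>(u, v)\<close> depends only on \<open>v - u\<close> modulo \<open>n\<close>.
  The characters of the cyclic group diagonalise every circulant matrix, so its eigenvalues are the
  values of the discrete Fourier transform of its first row
  (\<open>eigenvalue_circulant_iff\<close>). Let \<open>g j\<close> be the Fourier transform of the indicator function of
  \<open>S\<close>; these are the eigenvalues of the adjacency matrix, and \<open>g (- j)\<close> is the conjugate of
  \<open>g j\<close> because the indicator function is real.

  The weights \<open>1\<close>, \<open>- cnj omega3\<close> and \<open>- omega3\<close> of the Hermitian-adjacency matrix of the second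
  kind satisfy \<open>1 = - cnj omega3 - omega3\<close>. Hence that matrix is
  \<open>- cnj omega3 \<cdot> A - omega3 \<cdot> A\<^sup>T\<close> with \<open>A\<close> the adjacency matrix, and its \<open>j\<close>-th eigenvalue
  is the real number \<open>Re (g j) - sqrt 3 \<cdot> Im (g j)\<close> (\<open>fourier_herm_adj_mat2\<close>). The theorem thus compares
  two conditions on the numbers \<open>g j\<close>.

  If \<open>g j = a + b \<cdot> omega3\<close>, the expression equals \<open>a - 2 b\<close>, an integer.

  Conversely, suppose that the expression is an integer for all \<open>j\<close>. Taking \<open>j\<close> and
  \<open>- j\<close> together, \<open>Re (g j) \<plusminus> sqrt 3 \<cdot> Im (g j)\<close> are integers \<open>k\<close> and \<open>l\<close>. This puts \<open>g j\<close> in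
  the field generated by \<open>omega3\<close>, but the Eisenstein coordinates of \<open>g j\<close> have the denominator 3,
  which must be shown to cancel. For this, \<open>2 \<i> \<cdot> Im (g j) = g j - g (- j)\<close> is an eigenvalue of the
  integer matrix \<open>A - A\<^sup>T\<close>, so its square \<open>- (k - l)\<^sup>2 / 3\<close> is an algebraic integer
  (\<open>algebraic_int_Im_fourier\<close>). Being rational, it is an integer; therefore 3 divides \<open>k - l\<close>, and
  \<open>g j\<close> is an Eisenstein integer (\<open>eisensteinI\<close>).
\<close>

section \<open>Characters of the cyclic group\<close>

definition chi :: "nat \<Rightarrow> int \<Rightarrow> complex" where
  "chi n k = cis (2 * pi * (of_int k / of_nat n))"

lemma chi_0 [simp]: "chi n 0 = 1"
  by (simp add: chi_def)

lemma chi_add: "chi n (a + b) = chi n a * chi n b"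
  by (simp add: chi_def cis_mult add_divide_distrib algebra_simps)

lemma chi_uminus: "chi n (- a) = cnj (chi n a)"
  by (simp add: chi_def cis_cnj)

lemma chi_power: "chi n a ^ k = chi n (int k * a)"
  by (induction k) (simp_all add: chi_add algebra_simps)

lemma chi_multiple [simp]:
  assumes "n > 0"
  shows "chi n (int n * k) = 1"
  using assms by (simp add: chi_def)

text \<open>This lets residues modulo \<open>n\<close> be replaced by arbitrary representatives inside a character
  sum, where additivity can then be used.\<close>

lemma chi_mult_mod:
  assumes "n > 0"
  shows "chi n (j * (k mod int n)) = chi n (j * k)"
proof -
  have "j * k = j * (k mod int n) + int n * (j * (k div int n))"
    by (metis distrib_left mod_mult_div_eq mult.left_commute)
  then show ?thesis
    using assms by (simp add: chi_add)
qed

lemma chi_eq_1_imp_dvd: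
  assumes "n > 0" and "chi n k = 1"
  shows "int n dvd k"
proof -
  have "cos (2 * pi * (of_int k / of_nat n)) = 1"
    using assms(2) unfolding chi_def by (metis cis.simps(1) one_complex.simps(1))
  then obtain m :: int where "2 * pi * (of_int k / of_nat n) = of_int m * (2 * pi)"
    unfolding cos_one_2pi_int by auto
  then have "real_of_int k = of_int (m * int n)"
    using assms(1) by (simp add: field_simps)
  then have "k = m * int n"
    by (simp only: of_int_eq_iff)
  then show ?thesis
    by simp
qed

text \<open>Orthogonality of characters: a geometric sum whose ratio is an \<open>n\<close>-th root of unity
  vanishes unless the ratio is 1.\<close>

lemma chi_orthogonal:
  assumes "n > 0"
  shows "(\<Sum>j<n. chi n (int j * k)) = (if int n dvd k then of_nat n else 0)"
proof (cases "int n dvd k")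
  case True
  then obtain m where "k = int n * m"
    by (elim dvdE)
  then have "int j * k = int n * (int j * m)" for j
    by simp
  then have "chi n (int j * k) = 1" for j
    using assms by (simp only: chi_multiple)
  with True show ?thesis
    by simp
next
  case False
  then have "chi n k \<noteq> 1"
    using assms chi_eq_1_imp_dvd by blast
  then have "(\<Sum>j<n. chi n k ^ j) = (chi n k ^ n - 1) / (chi n k - 1)"
    by (rule geometric_sum)
  also have "\<dots> = 0"
    using assms by (simp add: chi_power)
  finally show ?thesis
    using False by (simp add: chi_power)
qed

section \<open>Spectra of circulant matrices\<close>

text \<open>The first row lists \<open>c 0, \<dots>, c (n - 1)\<close>. The entry type is arbitrary because the same
  construction is used for integer and for complex matrices.\<close>

definition circulant :: "nat \<Rightarrow> (int \<Rightarrow> 'a) \<Rightarrow> 'a mat" where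
  "circulant n c = mat n n (\<lambda>(u, v). c ((int v - int u) mod int n))"

text \<open>The frequency \<open>j\<close> ranges over all integers, so that the frequencies \<open>j\<close> and \<open>- j\<close> can be
  compared without reducing modulo \<open>n\<close>.\<close>

definition fourier :: "nat \<Rightarrow> (int \<Rightarrow> complex) \<Rightarrow> int \<Rightarrow> complex" where
  "fourier n c j = (\<Sum>s\<in>{0..<int n}. c s * chi n (j * s))"

lemma circulant_carrier [simp]: "circulant n c \<in> carrier_mat n n"
  by (simp add: circulant_def)

lemma sum_mod_reflect:
  fixes f :: "int \<Rightarrow> 'a::comm_monoid_add"
  shows "(\<Sum>s\<in>{0..<int n}. f ((a - s) mod int n)) = (\<Sum>s\<in>{0..<int n}. f s)"
proof (rule sum.reindex_bij_witness[where i = "\<lambda>s. (a - s) mod int n"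
      and j = "\<lambda>s. (a - s) mod int n"])
qed (auto simp: mod_diff_right_eq)

lemma sum_mod_shift:
  fixes f :: "int \<Rightarrow> 'a::comm_monoid_add"
  shows "(\<Sum>s\<in>{0..<int n}. f ((s - a) mod int n)) = (\<Sum>s\<in>{0..<int n}. f s)"
proof (rule sum.reindex_bij_witness[where i = "\<lambda>s. (s + a) mod int n"
      and j = "\<lambda>s. (s - a) mod int n"])
qed (auto simp: mod_diff_left_eq mod_add_left_eq)

lemma sum_int_lessThan: "(\<Sum>u<n. f (int u)) = (\<Sum>s\<in>{0..<int n}. f s)"
  by (rule sum.reindex_bij_witness[where i = nat and j = int]) auto

text \<open>The next two facts say that a character is a right eigenvector, and the conjugate character
  a left eigenvector, for the same eigenvalue. In both cases the substitution \<open>s = v - u\<close> turns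
  the sum into the Fourier transform.\<close>

lemma circulant_row_sum:
  assumes "n > 0"
  shows "(\<Sum>v<n. c ((int v - a) mod int n) * chi n (j * int v)) = fourier n c j * chi n (j * a)"
proof -
  have "(\<Sum>v<n. c ((int v - a) mod int n) * chi n (j * int v))
      = (\<Sum>v<n. c ((int v - a) mod int n) * chi n (j * ((int v - a) mod int n))) * chi n (j * a)"
    unfolding sum_distrib_right
    by (intro sum.cong refl)
       (simp add: chi_mult_mod[OF assms] mult.assoc chi_add[symmetric] ring_distribs[symmetric])
  then show ?thesis
    by (simp add: fourier_def sum_int_lessThan[where f = "\<lambda>v. c ((v - a) mod int n) * chi n (j * ((v - a) mod int n))"]
        sum_mod_shift[where f = "\<lambda>s. c s * chi n (j * s)"])
qed

lemma circulant_column_sum: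
  assumes "n > 0"
  shows "(\<Sum>u<n. c ((a - int u) mod int n) * chi n (- j * int u)) = fourier n c j * chi n (- j * a)"
proof -
  have "(\<Sum>u<n. c ((a - int u) mod int n) * chi n (- j * int u))
      = (\<Sum>u<n. c ((a - int u) mod int n) * chi n (j * ((a - int u) mod int n))) * chi n (- j * a)"
    unfolding sum_distrib_right
    by (intro sum.cong refl)
       (simp add: chi_mult_mod[OF assms] mult.assoc chi_add[symmetric] algebra_simps)
  then show ?thesis
    by (simp add: fourier_def sum_int_lessThan[where f = "\<lambda>u. c ((a - u) mod int n) * chi n (j * ((a - u) mod int n))"]
        sum_mod_reflect[where f = "\<lambda>s. c s * chi n (j * s)"])
qed

lemma circulant_mult_vec:
  assumes "u < n" and "v \<in> carrier_vec n"
  shows "(circulant n c *\<^sub>v v) $ u = (\<Sum>w<n. c ((int w - int u) mod int n) * v $ w)"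
  using assms by (simp add: circulant_def scalar_prod_def atLeast0LessThan)

lemma eigenvalue_circulant_fourier:
  assumes "n > 0"
  shows "eigenvalue (circulant n c) (fourier n c j)"
proof -
  define v where "v = vec n (\<lambda>u. chi n (j * int u))"
  have "circulant n c *\<^sub>v v = fourier n c j \<cdot>\<^sub>v v"
  proof (rule eq_vecI)
    fix u assume "u < dim_vec (fourier n c j \<cdot>\<^sub>v v)"
    then have u: "u < n" by (simp add: v_def)
    have "(circulant n c *\<^sub>v v) $ u = (\<Sum>w<n. c ((int w - int u) mod int n) * chi n (j * int w))"
      using u by (subst circulant_mult_vec) (auto simp: v_def)
    then show "(circulant n c *\<^sub>v v) $ u = (fourier n c j \<cdot>\<^sub>v v) $ u"
      using u by (simp add: circulant_row_sum[OF assms]) (simp add: v_def)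
  qed (simp add: v_def circulant_def)
  moreover have "v \<noteq> 0\<^sub>v n"
  proof
    assume "v = 0\<^sub>v n"
    then have "v $ 0 = 0" using assms by simp
    then show False using assms by (simp add: v_def)
  qed
  ultimately show ?thesis
    unfolding eigenvalue_def eigenvector_def by (intro exI[of _ v]) (simp add: v_def circulant_def)
qed

text \<open>Injectivity of the discrete Fourier transform on vectors: by orthogonality each coordinate of
  \<open>v\<close> is recovered from the transform.\<close>

lemma fourier_vec_nonzero:
  assumes "n > 0" and "v \<in> carrier_vec n" and "v \<noteq> 0\<^sub>v n"
  obtains j :: nat where "(\<Sum>u<n. chi n (- int j * int u) * v $ u) \<noteq> 0"
proof (rule ccontr)
  assume "\<not> thesis"
  with that have zero: "(\<Sum>u<n. chi n (- int j * int u) * v $ u) = 0" for j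
    by blast
  have "v $ w = 0" if w: "w < n" for w
  proof -
    have split: "chi n (int j * (int w - int u)) = chi n (int j * int w) * chi n (- int j * int u)" for j u
      by (simp add: chi_add[symmetric] right_diff_distrib)
    have "0 = (\<Sum>j<n. chi n (int j * int w) * (\<Sum>u<n. chi n (- int j * int u) * v $ u))"
      by (simp only: zero) simp
    also have "\<dots> = (\<Sum>j<n. \<Sum>u<n. chi n (int j * (int w - int u)) * v $ u)"
      by (simp only: split sum_distrib_left mult.assoc)
    also have "\<dots> = (\<Sum>u<n. (\<Sum>j<n. chi n (int j * (int w - int u))) * v $ u)"
      by (subst sum.swap) (simp add: sum_distrib_right)
    also have "\<dots> = (\<Sum>u<n. if u = w then of_nat n * v $ u else 0)"
    proof (intro sum.cong refl)
      fix u assume "u \<in> {..<n}"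
      then have "int n dvd int w - int u \<longleftrightarrow> u = w"
        using w by (auto simp: mod_eq_dvd_iff[symmetric])
      then show "(\<Sum>j<n. chi n (int j * (int w - int u))) * v $ u
          = (if u = w then of_nat n * v $ u else 0)"
        by (simp add: chi_orthogonal[OF assms(1)])
    qed
    also have "\<dots> = of_nat n * v $ w"
      using w by simp
    finally show ?thesis
      using assms(1) by simp
  qed
  then have "v = 0\<^sub>v n"
    using assms(2) by (intro eq_vecI) auto
  with assms(3) show False ..
qed

text \<open>There are no further eigenvalues. Pair an eigenvector for \<open>x\<close> with a left eigenvector given by
  a character, chosen so that the pairing is nonzero; the two eigenvalues must then agree.\<close>

lemma eigenvalue_circulant_imp_fourier:
  assumes "n > 0" and "eigenvalue (circulant n c) x"
  obtains j where "x = fourier n c j"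
proof -
  have dim: "dim_row (circulant n c) = n"
    by (simp add: circulant_def)
  obtain v where v: "v \<in> carrier_vec n" "v \<noteq> 0\<^sub>v n" and eig: "circulant n c *\<^sub>v v = x \<cdot>\<^sub>v v"
    using assms(2) unfolding eigenvalue_def eigenvector_def dim by blast
  obtain j :: nat where j: "(\<Sum>u<n. chi n (- int j * int u) * v $ u) \<noteq> 0"
    using fourier_vec_nonzero[OF assms(1) v] .
  have "x * (\<Sum>u<n. chi n (- int j * int u) * v $ u)
      = (\<Sum>u<n. chi n (- int j * int u) * (circulant n c *\<^sub>v v) $ u)"
    using v by (simp add: eig sum_distrib_left mult.left_commute)
  also have "\<dots> = (\<Sum>u<n. \<Sum>w<n. c ((int w - int u) mod int n) * chi n (- int j * int u) * v $ w)"
    using v by (intro sum.cong refl) (simp add: circulant_mult_vec sum_distrib_left mult_ac)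
  also have "\<dots> = (\<Sum>w<n. (\<Sum>u<n. c ((int w - int u) mod int n) * chi n (- int j * int u)) * v $ w)"
    by (subst sum.swap) (simp add: sum_distrib_right)
  also have "\<dots> = fourier n c (int j) * (\<Sum>w<n. chi n (- int j * int w) * v $ w)"
    by (simp only: circulant_column_sum[OF assms(1)] sum_distrib_left mult.assoc)
  finally show thesis
    using j that by simp
qed

lemma eigenvalue_circulant_iff:
  assumes "n > 0"
  shows "eigenvalue (circulant n c) x \<longleftrightarrow> (\<exists>j. x = fourier n c j)"
  using eigenvalue_circulant_fourier[OF assms] eigenvalue_circulant_imp_fourier[OF assms] by metis

lemma fourier_add: "fourier n (\<lambda>s. c s + d s) j = fourier n c j + fourier n d j"
  by (simp add: fourier_def sum.distrib algebra_simps)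

lemma fourier_diff: "fourier n (\<lambda>s. c s - d s) j = fourier n c j - fourier n d j"
  by (simp add: fourier_def sum_subtractf algebra_simps)

lemma fourier_cmult: "fourier n (\<lambda>s. a * c s) j = a * fourier n c j"
  by (simp add: fourier_def sum_distrib_left mult.assoc)

text \<open>Reflecting the first row transposes the circulant matrix, and acts on its
  eigenvalues by exchanging \<open>j\<close> and \<open>- j\<close>.\<close>

lemma fourier_reflect:
  assumes "n > 0"
  shows "fourier n (\<lambda>s. c (- s mod int n)) j = fourier n c (- j)"
proof -
  have "fourier n (\<lambda>s. c (- s mod int n)) j
      = (\<Sum>s\<in>{0..<int n}. c ((0 - s) mod int n) * chi n (- j * ((0 - s) mod int n)))"
    unfolding fourier_def
    by (intro sum.cong refl) (simp only: chi_mult_mod[OF assms] diff_0 minus_mult_minus)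
  then show ?thesis
    by (simp add: fourier_def sum_mod_reflect[where f = "\<lambda>s. c s * chi n (- j * s)" and a = 0, simplified])
qed

lemma fourier_uminus_real:
  assumes "\<And>s. c s \<in> \<real>"
  shows "fourier n c (- j) = cnj (fourier n c j)"
  using assms by (simp add: fourier_def chi_uminus Reals_cnj_iff)

section \<open>Eigenvalues of integer matrices\<close>

text \<open>The characteristic polynomial is monic with integer coefficients.\<close>

lemma eigenvalue_int_mat_algebraic_int:
  assumes "B \<in> carrier_mat n n" and "eigenvalue (map_mat of_int B) (x :: complex)"
  shows "algebraic_int x"
proof -
  have carrier: "map_mat of_int B \<in> carrier_mat n n"
    using assms(1) by simp
  have "poly (map_poly of_int (char_poly B)) x = 0"
    using assms(2) eigenvalue_root_char_poly[OF carrier] of_int_hom.char_poly_hom[OF assms(1)]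
    by metis
  moreover have "lead_coeff (char_poly B) = 1"
    using degree_monic_char_poly[OF assms(1)] by simp
  ultimately show ?thesis
    unfolding algebraic_int_altdef_ipoly by blast
qed

text \<open>Taking powers of the matrix shows that powers of the eigenvalue are algebraic integers,
  without appealing to closure of the algebraic integers under multiplication.\<close>

lemma eigenvalue_int_mat_power_algebraic_int:
  assumes "B \<in> carrier_mat n n" and "eigenvalue (map_mat of_int B) (x :: complex)"
  shows "algebraic_int (x ^ k)"
proof (rule eigenvalue_int_mat_algebraic_int)
  show "B ^\<^sub>m k \<in> carrier_mat n n"
    using assms(1) by simp
  have carrier: "map_mat of_int B \<in> carrier_mat n n"
    using assms(1) by simp
  have "eigenvalue (map_mat of_int B ^\<^sub>m k) (x ^ k)"
    using assms carrier eigenvector_pow[OF carrier, of _ x k]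
    unfolding eigenvalue_def eigenvector_def
    by (auto simp: pow_mat_dim_square)
  then show "eigenvalue (map_mat of_int (B ^\<^sub>m k)) (x ^ k)"
    using of_int_hom.mat_hom_pow[OF assms(1)] by metis
qed

section \<open>The two spectra of a mixed circulant graph\<close>

lemma adj_mat_Circ:
  "adj_mat n (Circ n S) = circulant n (indicator S)"
  by (rule eq_matI) (auto simp: adj_mat_def Circ_def circulant_def)

text \<open>Since \<open>- cnj omega3 = (1 + \<i> sqrt 3) / 2\<close> and \<open>- omega3 = (1 - \<i> sqrt 3) / 2\<close> add up to 1,
  one linear formula covers undirected edges, both kinds of directed edges, and non-edges.\<close>

lemma herm_adj_mat2_Circ:
  fixes S :: "int set"
  defines "c \<equiv> indicator S"
  shows "herm_adj_mat2 n (Circ n S) = circulant n (\<lambda>s. - cnj omega3 * c s + - omega3 * c (- s mod int n))"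
proof (rule eq_matI)
  fix u v
  assume "u < dim_row (circulant n (\<lambda>s. - cnj omega3 * c s + - omega3 * c (- s mod int n)))"
    and "v < dim_col (circulant n (\<lambda>s. - cnj omega3 * c s + - omega3 * c (- s mod int n)))"
  then have uv: "u < n" "v < n"
    by (simp_all add: circulant_def)
  have "- ((int v - int u) mod int n) mod int n = (int u - int v) mod int n"
    by (simp add: mod_minus_eq)
  then show "herm_adj_mat2 n (Circ n S) $$ (u, v)
      = circulant n (\<lambda>s. - cnj omega3 * c s + - omega3 * c (- s mod int n)) $$ (u, v)"
    using uv
    by (auto simp: herm_adj_mat2_def Circ_def circulant_def c_def omega3_def indicator_def complex_eq_iff)
qed (simp_all add: herm_adj_mat2_def circulant_def)

text \<open>The two summands transform to \<open>- cnj omega3 \<cdot> z\<close> and its conjugate, where \<open>z\<close> is the transform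
  of the indicator function; the result is twice the real part of the first.\<close>

lemma fourier_herm_adj_mat2:
  fixes S :: "int set"
  defines "c \<equiv> indicator S"
  assumes "n > 0"
  shows "fourier n (\<lambda>s. - cnj omega3 * c s + - omega3 * c (- s mod int n)) j
    = of_real (Re (fourier n c j) - sqrt 3 * Im (fourier n c j))"
proof -
  have "fourier n c (- j) = cnj (fourier n c j)"
    by (rule fourier_uminus_real) (auto simp: c_def indicator_def)
  then have "fourier n (\<lambda>s. - cnj omega3 * c s + - omega3 * c (- s mod int n)) j
      = - cnj omega3 * fourier n c j + - omega3 * cnj (fourier n c j)"
    by (simp only: fourier_add fourier_cmult fourier_reflect[OF assms(2)])
  then show ?thesis
    by (simp add: omega3_def complex_eq_iff field_simps)
qed

text \<open>Twice the imaginary part, times \<open>\<i>\<close>, is an eigenvalue of the difference of the adjacency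
  matrix and its transpose. The square is taken because this is the quantity that
  becomes rational for an HS-integral graph.\<close>

lemma algebraic_int_Im_fourier:
  fixes S :: "int set"
  assumes "n > 0"
  shows "algebraic_int ((2 * \<i> * of_real (Im (fourier n (indicator S) j))) ^ 2)"
proof (rule eigenvalue_int_mat_power_algebraic_int)
  define c :: "int \<Rightarrow> complex" where "c = indicator S"
  define B :: "int mat" where
    "B = circulant n (\<lambda>s. indicator S s - indicator S (- s mod int n))"
  show "B \<in> carrier_mat n n"
    by (simp add: B_def)
  have "fourier n c (- j) = cnj (fourier n c j)"
    by (rule fourier_uminus_real) (auto simp: c_def indicator_def)
  then have "fourier n (\<lambda>s. c s - c (- s mod int n)) j = 2 * \<i> * of_real (Im (fourier n c j))"
    by (simp add: fourier_diff fourier_reflect[OF assms] complex_eq_iff)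
  moreover have "map_mat of_int B = circulant n (\<lambda>s. c s - c (- s mod int n))"
    by (rule eq_matI) (auto simp: B_def circulant_def c_def indicator_def)
  ultimately show "eigenvalue (map_mat of_int B) (2 * \<i> * of_real (Im (fourier n (indicator S) j)))"
    using eigenvalue_circulant_fourier[OF assms] by (metis c_def)
qed

section \<open>Recognising Eisenstein integers\<close>

lemma eisenstein_Re_minus_sqrt3_Im:
  assumes "z \<in> eisenstein_integers"
  shows "Re z - sqrt 3 * Im z \<in> \<int>"
proof -
  obtain a b :: int where "z = of_int a + of_int b * omega3"
    using assms by (auto simp: eisenstein_integers_def)
  then have "Re z = a - b / 2" and im: "Im z = b * sqrt 3 / 2"
    by (simp_all add: omega3_def)
  moreover have "sqrt 3 * Im z = 3 * b / 2"
    by (simp add: im)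
  ultimately have "Re z - sqrt 3 * Im z = of_int (a - 2 * b)"
    by simp
  then show ?thesis
    by (metis Ints_of_int)
qed

text \<open>With \<open>k\<close> and \<open>l\<close> the two integers of the hypotheses, \<open>z = (k + l) / 2 + \<i> (k - l) / (2 sqrt 3)\<close>.
  Matching imaginary parts, the coefficient of \<open>omega3\<close> has to be \<open>(k - l) / 3\<close>. The square in
  the last hypothesis is the rational number \<open>- (k - l)\<^sup>2 / 3\<close>, so integrality forces
  3 to divide \<open>k - l\<close>.\<close>

lemma eisensteinI:
  assumes plus: "Re z + sqrt 3 * Im z \<in> \<int>" and minus: "Re z - sqrt 3 * Im z \<in> \<int>"
    and alg: "algebraic_int ((2 * \<i> * of_real (Im z)) ^ 2)"
  shows "z \<in> eisenstein_integers"
proof -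
  obtain k l :: int where k: "Re z + sqrt 3 * Im z = of_int k" and l: "Re z - sqrt 3 * Im z = of_int l"
    using plus minus by (auto elim!: Ints_cases)
  have re: "Re z = of_int (k + l) / 2" and im: "Im z = of_int (k - l) / (2 * sqrt 3)"
    using k l by (simp_all add: field_simps)
  have "(2 * \<i> * of_real (Im z)) ^ 2 = (of_real (- (4 * (Im z)\<^sup>2)) :: complex)"
    by (simp add: power_mult_distrib)
  also have "- (4 * (Im z)\<^sup>2) = - (of_int (k - l))\<^sup>2 / 3"
    by (simp add: im power_divide power_mult_distrib)
  finally have sq: "algebraic_int (- (of_int (k - l))\<^sup>2 / 3 :: real)"
    using alg by (simp only: algebraic_int_of_real_iff)
  have "(- (of_int (k - l))\<^sup>2 / 3 :: real) \<in> \<int>"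
    by (rule rational_algebraic_int_is_int[OF sq]) simp
  then obtain m :: int where "- (of_int (k - l))\<^sup>2 / 3 = real_of_int m"
    by (rule Ints_cases)
  then have "real_of_int ((k - l)\<^sup>2) = of_int (3 * (- m))"
    by simp
  then have "(k - l)\<^sup>2 = 3 * (- m)"
    by (simp only: of_int_eq_iff)
  then have "3 dvd (k - l)\<^sup>2"
    by simp
  moreover have "prime (3 :: int)"
    by simp
  ultimately have "3 dvd k - l"
    using prime_dvd_power by blast
  then obtain q where q: "k - l = 3 * q"
    by (elim dvdE)
  have "z = of_int (l + 2 * q) + of_int q * omega3"
  proof -
    have "k = l + 3 * q"
      using q by simp
    then show ?thesis
      by (simp add: complex_eq_iff re im omega3_def real_div_sqrt field_simps)
  qed
  then show ?thesis
    unfolding eisenstein_integers_def by blast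
qed

section \<open>Eisenstein integral and HS-integral circulant graphs\<close>

theorem theorem5p8:
  fixes n :: nat and S :: "int set"
  assumes "n \<ge> 2"
    and "S \<subseteq> {0..<int n}"
    and "0 \<notin> S"
  shows "eisenstein_integral n (Circ n S) \<longleftrightarrow> HS_integral n (Circ n S)"
proof -
  have n: "n > 0"
    using assms(1) by simp
  define g where "g = fourier n (indicator S)"
  have g_uminus: "g (- j) = cnj (g j)" for j
    unfolding g_def by (rule fourier_uminus_real) (auto simp: indicator_def)
  have eisenstein: "eisenstein_integral n (Circ n S) \<longleftrightarrow> (\<forall>j. g j \<in> eisenstein_integers)"
    unfolding eisenstein_integral_def adj_mat_Circ eigenvalue_circulant_iff[OF n] g_def by blast
  have "HS_integral n (Circ n S) \<longleftrightarrow>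
      (\<forall>j. complex_of_real (Re (g j) - sqrt 3 * Im (g j)) \<in> \<int>)"
    unfolding HS_integral_def herm_adj_mat2_Circ eigenvalue_circulant_iff[OF n]
      fourier_herm_adj_mat2[OF n] g_def by blast
  then have HS: "HS_integral n (Circ n S) \<longleftrightarrow> (\<forall>j. Re (g j) - sqrt 3 * Im (g j) \<in> \<int>)"
    by (simp only: of_real_in_Ints_iff)
  show ?thesis
    unfolding eisenstein HS
  proof
    assume "\<forall>j. g j \<in> eisenstein_integers"
    then show "\<forall>j. Re (g j) - sqrt 3 * Im (g j) \<in> \<int>"
      using eisenstein_Re_minus_sqrt3_Im by blast
  next
    assume int: "\<forall>j. Re (g j) - sqrt 3 * Im (g j) \<in> \<int>"
    show "\<forall>j. g j \<in> eisenstein_integers"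
    proof
      fix j
      show "g j \<in> eisenstein_integers"
      proof (rule eisensteinI)
        have "Re (g (- j)) - sqrt 3 * Im (g (- j)) \<in> \<int>"
          using int by blast
        then show "Re (g j) + sqrt 3 * Im (g j) \<in> \<int>"
          by (simp add: g_uminus)
        show "Re (g j) - sqrt 3 * Im (g j) \<in> \<int>"
          using int by blast
        show "algebraic_int ((2 * \<i> * of_real (Im (g j))) ^ 2)"
          unfolding g_def by (rule algebraic_int_Im_fourier[OF n])
      qed
    qed
  qed
qed

end
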